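(* Let $E$ be a vector space over a field $K$. Computability is stable over the vector space $\langle K,E,+,\times,+,.\rangle$ if and only if it is stable over the field $\langle K,+,\times\rangle$ and $\langle K,E,+,\times,+,.\rangle$ is a finite-dimensional vector space.
   Context: Computability over natural numbers is the usual one. A set $A \subseteq \mathbb{N}$ is effectively enumerable if it is empty or the image of a total computable function from $\mathbb{N}$ to $\mathbb{N}$. For $A \subseteq \mathbb{N}^m$ and $B \subseteq \mathbb{N}$, a computable function from $A$ to $B$ is a partial computable function that is defined at every element of $A$ and takes values in $B$ there. Indexing: an indexing of a set $E$ is a partial function $i$ from $\mathbb{N}$ to $E$ such that $dom(i)$ is effectively enumerable, $i$ is surjective, and there is a computable function $eq$ from $dom(i)\times dom(i)$ to $\{0,1\}$ with $eq(x,y)=1$ if $i(x)=i(y)$ and $eq(x,y)=0$ otherwise. An indexing of a family of sets $E_1,\ldots,E_n$ is a family $i_1,\ldots,i_n$ of indexings of $E_1,\ldots,E_n$. Computable function: given sets $E_1,\ldots,E_m,E_{m+1}$ with indexings $i_1,\ldots,i_{m+1}$, a function $f: E_1\times\ldots\times E_m \to E_{m+1}$ is computable relatively to this indexing if there is a computable function $\hat f$ from $dom(i_1)\times\ldots\times dom(i_m)$ to $dom(i_{m+1})$ such that $i_{m+1}(\hat f(x_1,\ldots,x_m)) = f(i_1(x_1),\ldots,i_m(x_m))$ for all $x_k \in dom(i_k)$. Admissible indexing: a structure $\langle E_1,\ldots,E_n,op_1,\ldots,op_p\rangle$ consists of sets $E_1,\ldots,E_n$ and operations, each from a product of some of these sets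 to one of these sets. An indexing of it is an indexing of $E_1,\ldots,E_n$; it is admissible if every $op_k$ is computable relatively to the indexings of its domains and co-domain. Stable computability: computability is stable over $\langle E_1,\ldots,E_n,op_1,\ldots,op_p\rangle$ if there exists an admissible indexing of this structure and, for all admissible indexings $j_1,\ldots,j_n$ and $j'_1,\ldots,j'_n$ of it, there exist computable functions $h_k$ from $dom(j'_k)$ to $dom(j_k)$ such that $j'_k = j_k\circ h_k$, for $k=1,\ldots,n$. A vector space $E$ over a field $K$ is viewed as the two-sorted structure $\langle K,E,+,\times,+,.\rangle$, with the addition and multiplication of $K$, the addition of $E$ and the multiplication of a vector by a scalar. *)

theory Defs
  imports Complex_Main
begin

section \<open>Computability over the natural numbers\<close>

text \<open>Programs for the partial recursive functions. Tuples of natural numbers are lists. Programs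
  carry no arity: run on the lists of a fixed length \<open>m\<close>, a program computes an \<open>m\<close>-ary partial
  recursive function, and an application with a wrong number of arguments is either undefined or
  ignores the additional ones.\<close>

datatype recf =
    Zero
  | Succ
  | Proj nat
  | Comp recf "recf list"
  | PrimRec recf recf
  | Mu recf

fun reval :: "recf \<Rightarrow> nat list \<Rightarrow> nat option" where
  "reval Zero xs = Some 0"
| "reval Succ xs = (case xs of [] \<Rightarrow> None | x # _ \<Rightarrow> Some (Suc x))"
| "reval (Proj i) xs = (if i < length xs then Some (xs ! i) else None)"
| "reval (Comp f gs) xs = Option.bind (those (map (\<lambda>g. reval g xs) gs)) (reval f)"
| "reval (PrimRec f g) xs =
    (case xs of [] \<Rightarrow> None
     | n # ys \<Rightarrow> rec_nat (reval f ys) (\<lambda>k r. Option.bind r (\<lambda>y. reval g (k # y # ys))) n)"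
| "reval (Mu f) xs =
    (if \<exists>n. reval f (n # xs) = Some 0 \<and> (\<forall>k<n. \<exists>y. reval f (k # xs) = Some (Suc y))
     then Some (LEAST n. reval f (n # xs) = Some 0) else None)"

text \<open>A partial \<open>m\<close>-ary function is given on lists of length \<open>m\<close>; its values elsewhere are
  irrelevant.\<close>

definition partial_computable :: "nat \<Rightarrow> (nat list \<rightharpoonup> nat) \<Rightarrow> bool" where
  "partial_computable m f \<longleftrightarrow> (\<exists>p. \<forall>xs. length xs = m \<longrightarrow> f xs = reval p xs)"

text \<open>A computable function from \<open>A \<subseteq> \<nat>\<^sup>m\<close> to \<open>B\<close> may also be defined outside \<open>A\<close>.\<close>

definition computable_from_to :: "nat \<Rightarrow> nat list set \<Rightarrow> nat set \<Rightarrow> (nat list \<rightharpoonup> nat) \<Rightarrow> bool" where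
  "computable_from_to m A B f \<longleftrightarrow>
     A \<subseteq> {xs. length xs = m} \<and> partial_computable m f \<and> (\<forall>xs\<in>A. \<exists>y\<in>B. f xs = Some y)"

definition effectively_enumerable :: "nat set \<Rightarrow> bool" where
  "effectively_enumerable A \<longleftrightarrow>
     A = {} \<or> (\<exists>f. computable_from_to 1 {xs. length xs = 1} UNIV f \<and> A = range (\<lambda>n. the (f [n])))"

section \<open>Indexings\<close>

definition indexing :: "'u set \<Rightarrow> (nat \<rightharpoonup> 'u) \<Rightarrow> bool" where
  "indexing E i \<longleftrightarrow>
     effectively_enumerable (dom i) \<and> ran i = E \<and>
     (\<exists>eq. computable_from_to 2 (listset [dom i, dom i]) {0, 1} eq \<and>
           (\<forall>x\<in>dom i. \<forall>y\<in>dom i. eq [x, y] = Some (if i x = i y then 1 else 0)))"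

definition computable_rel ::
    "(nat \<rightharpoonup> 'u) list \<Rightarrow> (nat \<rightharpoonup> 'u) \<Rightarrow> ('u list \<Rightarrow> 'u) \<Rightarrow> bool" where
  "computable_rel js j f \<longleftrightarrow>
     (\<exists>f'. computable_from_to (length js) (listset (map dom js)) (dom j) f' \<and>
           (\<forall>xs\<in>listset (map dom js). j (the (f' xs)) = Some (f (map2 (\<lambda>i x. the (i x)) js xs))))"

section \<open>Many-sorted structures\<close>

text \<open>All sorts of a structure are subsets of one type. An operation \<open>(ss, t, f)\<close> maps the product
  of the sorts with the positions \<open>ss\<close> to the sort with the position \<open>t\<close>; \<open>f\<close> is only relevant on
  this product.\<close>

record 'u many_sorted =
  sorts :: "'u set list"
  opers :: "(nat list \<times> nat \<times> ('u list \<Rightarrow> 'u)) list"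

definition wf_many_sorted :: "'u many_sorted \<Rightarrow> bool" where
  "wf_many_sorted S \<longleftrightarrow>
     (\<forall>(ss, t, f)\<in>set (opers S).
        (\<forall>s\<in>set ss. s < length (sorts S)) \<and> t < length (sorts S) \<and>
        (\<forall>us\<in>listset (map ((!) (sorts S)) ss). f us \<in> sorts S ! t))"

definition admissible_indexing :: "'u many_sorted \<Rightarrow> (nat \<rightharpoonup> 'u) list \<Rightarrow> bool" where
  "admissible_indexing S js \<longleftrightarrow>
     list_all2 indexing (sorts S) js \<and>
     (\<forall>(ss, t, f)\<in>set (opers S). computable_rel (map ((!) js) ss) (js ! t) f)"

text \<open>The equation \<open>j' = j \<circ> h\<close> is one between functions on \<open>dom j'\<close>.\<close>

definition stable_computability :: "'u many_sorted \<Rightarrow> bool" where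
  "stable_computability S \<longleftrightarrow>
     (\<exists>js. admissible_indexing S js) \<and>
     (\<forall>js js'. admissible_indexing S js \<and> admissible_indexing S js' \<longrightarrow>
        (\<forall>k<length (sorts S). \<exists>h.
           computable_from_to 1 (listset [dom (js' ! k)]) (dom (js ! k)) h \<and>
           (\<forall>x\<in>dom (js' ! k). (js' ! k) x = (js ! k) (the (h [x])))))"

section \<open>Fields and vector spaces as structures\<close>

definition field_structure :: "'k::field many_sorted" where
  "field_structure =
     \<lparr>sorts = [UNIV],
      opers = [([0, 0], 0, \<lambda>us. us ! 0 + us ! 1),
               ([0, 0], 0, \<lambda>us. us ! 0 * us ! 1)]\<rparr>"

definition vector_space_structure ::
    "('k::field \<Rightarrow> 'e::ab_group_add \<Rightarrow> 'e) \<Rightarrow> ('k + 'e) many_sorted" where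
  "vector_space_structure scale =
     \<lparr>sorts = [range Inl, range Inr],
      opers = [([0, 0], 0, \<lambda>us. Inl (projl (us ! 0) + projl (us ! 1))),
               ([0, 0], 0, \<lambda>us. Inl (projl (us ! 0) * projl (us ! 1))),
               ([1, 1], 1, \<lambda>us. Inr (projr (us ! 0) + projr (us ! 1))),
               ([0, 1], 1, \<lambda>us. Inr (scale (projl (us ! 0)) (projr (us ! 1))))]\<rparr>"

lemma wf_field_structure: "wf_many_sorted field_structure"
  by (simp add: wf_many_sorted_def field_structure_def)

lemma wf_vector_space_structure: "wf_many_sorted (vector_space_structure scale)"
  by (simp add: wf_many_sorted_def vector_space_structure_def)

end

theory Submission
  imports Defs "HOL-Library.Countable" "HOL-Library.Nat_Bijection"
begin

text \<open>If the dimension is finite, an indexing of \<open>K\<close> yields one of \<open>E\<close> by coordinate tuples, so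
  stability passes from \<open>E\<close> to \<open>K\<close>. Conversely, given two indexings of \<open>E\<close> and a translation between
  those of \<open>K\<close>, the code of a vector is translated by searching for the linear combination of the
  basis that it denotes and evaluating the same combination in the other indexing. In infinite
  dimension, composing an indexing with a linear automorphism of \<open>E\<close> gives another admissible
  indexing, so stability would make every automorphism computable; but there are uncountably many.\<close>

section \<open>Programs on promised inputs\<close>

text \<open>\<open>D\<close> is a promise: outside it the program may diverge or return anything.
  Since \<open>f\<close> is total, compositions can be written without options, and since
  \<open>D\<close> may be any set of lists, it can also carry a search variable in front of the
  inputs.\<close>

definition computable_on :: "nat list set \<Rightarrow> (nat list \<Rightarrow> nat) \<Rightarrow> bool" where
  "computable_on D f \<longleftrightarrow> (\<exists>p. \<forall>xs\<in>D. reval p xs = Some (f xs))"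

abbreviation computable1 :: "nat set \<Rightarrow> (nat \<Rightarrow> nat) \<Rightarrow> bool" where
  "computable1 A f \<equiv> computable_on (listset [A]) (\<lambda>xs. f (xs ! 0))"

abbreviation computable2 :: "nat set \<Rightarrow> nat set \<Rightarrow> (nat \<Rightarrow> nat \<Rightarrow> nat) \<Rightarrow> bool" where
  "computable2 A B f \<equiv> computable_on (listset [A, B]) (\<lambda>xs. f (xs ! 0) (xs ! 1))"

lemma listset1: "xs \<in> listset [A] \<longleftrightarrow> (\<exists>x\<in>A. xs = [x])"
  by (auto simp: set_Cons_def)

lemma listset2: "xs \<in> listset [A, B] \<longleftrightarrow> (\<exists>x\<in>A. \<exists>y\<in>B. xs = [x, y])"
  by (auto simp: set_Cons_def)

lemma listset1_UNIV: "listset [UNIV] = {xs. length xs = 1}"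
  by (auto simp: listset1 length_Suc_conv set_Cons_def)

lemma computable_on_cong:
  assumes "computable_on D f" and "\<And>xs. xs \<in> D \<Longrightarrow> f xs = g xs"
  shows "computable_on D g"
  using assms by (metis computable_on_def)

lemma computable_on_nth:
  assumes "\<And>xs. xs \<in> D \<Longrightarrow> i < length xs"
  shows "computable_on D (\<lambda>xs. xs ! i)"
  unfolding computable_on_def by (rule exI[of _ "Proj i"]) (simp add: assms)

text \<open>The last premise keeps the promise under which the outer program is known to
  work.\<close>

lemma computable_on_comp1:
  assumes "computable1 A f" and "computable_on D g" and "\<And>xs. xs \<in> D \<Longrightarrow> g xs \<in> A"
  shows "computable_on D (\<lambda>xs. f (g xs))"
proof -
  obtain p where p: "\<forall>xs\<in>listset [A]. reval p xs = Some (f (xs ! 0))"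
    using assms(1) unfolding computable_on_def by blast
  obtain q where q: "\<forall>xs\<in>D. reval q xs = Some (g xs)"
    using assms(2) unfolding computable_on_def by blast
  have "reval (Comp p [q]) xs = Some (f (g xs))" if "xs \<in> D" for xs
    using that q assms(3) bspec[OF p, of "[g xs]"] by (simp add: set_Cons_def)
  then show ?thesis unfolding computable_on_def by blast
qed

lemma computable_on_comp2:
  assumes "computable2 A B f" and "computable_on D g" and "computable_on D h"
    and "\<And>xs. xs \<in> D \<Longrightarrow> g xs \<in> A" and "\<And>xs. xs \<in> D \<Longrightarrow> h xs \<in> B"
  shows "computable_on D (\<lambda>xs. f (g xs) (h xs))"
proof -
  obtain p where p: "\<forall>xs\<in>listset [A, B]. reval p xs = Some (f (xs ! 0) (xs ! 1))"
    using assms(1) unfolding computable_on_def by blast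
  obtain q where q: "\<forall>xs\<in>D. reval q xs = Some (g xs)"
    using assms(2) unfolding computable_on_def by blast
  obtain r where r: "\<forall>xs\<in>D. reval r xs = Some (h xs)"
    using assms(3) unfolding computable_on_def by blast
  have "reval (Comp p [q, r]) xs = Some (f (g xs) (h xs))" if "xs \<in> D" for xs
    using that q r assms(4,5) bspec[OF p, of "[g xs, h xs]"] by (simp add: set_Cons_def)
  then show ?thesis unfolding computable_on_def by blast
qed

section \<open>Arithmetic and unbounded search\<close>

lemma computable_on_Suc:
  assumes "computable_on D f"
  shows "computable_on D (\<lambda>xs. Suc (f xs))"
proof -
  have "computable1 UNIV Suc"
    unfolding computable_on_def by (rule exI[of _ Succ]) (auto simp: set_Cons_def)
  from computable_on_comp1[OF this assms] show ?thesis by simp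
qed

lemma computable_on_const: "computable_on D (\<lambda>_. c)"
proof (induction c)
  case 0
  show ?case unfolding computable_on_def by (rule exI[of _ Zero]) simp
next
  case (Suc c)
  then show ?case by (rule computable_on_Suc)
qed

lemma computable_on_add:
  assumes "computable_on D f" and "computable_on D g"
  shows "computable_on D (\<lambda>xs. f xs + g xs)"
proof -
  \<comment> \<open>This is what \<open>reval\<close> makes of the program below. A recursion step
    receives the counter \<open>k\<close>, the previous value \<open>y\<close> and the remaining
    inputs, so \<open>Proj 1\<close> is the previous value.\<close>
  have "rec_nat (Some m) (\<lambda>k r. Option.bind r (\<lambda>y. Some (Suc y))) n = Some (n + m)" for n m :: nat
    by (induction n) auto
  then have "computable2 UNIV UNIV (+)"
    unfolding computable_on_def
    by (intro exI[of _ "PrimRec (Proj 0) (Comp Succ [Proj 1])"]) (auto simp: set_Cons_def)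
  from computable_on_comp2[OF this assms] show ?thesis by simp
qed

lemma computable_on_diff:
  assumes "computable_on D f" and "computable_on D g"
  shows "computable_on D (\<lambda>xs. f xs - g xs)"
proof -
  \<comment> \<open>The recursion step returns its counter, so a successor is sent to its
    predecessor and 0 to 0.\<close>
  define pred where "pred = PrimRec Zero (Proj 0)"
  have "rec_nat (Some 0) (\<lambda>k r. Option.bind r (\<lambda>y. Some k)) n = Some (n - 1)" for n :: nat
    by (induction n) auto
  then have pred: "reval pred [n] = Some (n - 1)" for n
    by (simp add: pred_def)
  have "rec_nat (Some m) (\<lambda>k r. Option.bind r (\<lambda>y. Some (y - Suc 0))) n = Some (m - n)"
    for n m :: nat
    by (induction n) auto
  \<comment> \<open>\<open>PrimRec\<close> recurses on its first argument, so the number to be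
    subtracted comes first; the final composition swaps the arguments back.\<close>
  then have "computable2 UNIV UNIV (\<lambda>n m. m - n)"
    unfolding computable_on_def
    by (intro exI[of _ "PrimRec (Proj 0) (Comp pred [Proj 1])"]) (auto simp: set_Cons_def pred)
  from computable_on_comp2[OF this assms(2,1)] show ?thesis by simp
qed

lemma computable_on_triangle:
  assumes "computable_on D f"
  shows "computable_on D (\<lambda>xs. triangle (f xs))"
proof -
  \<comment> \<open>The recursion step comes from
    \<open>triangle (Suc k) = triangle k + Suc k\<close>.\<close>
  have "computable2 UNIV UNIV (\<lambda>k y. y + Suc k)"
    by (intro computable_on_add computable_on_Suc computable_on_nth) (auto simp: set_Cons_def)
  then obtain p where "\<forall>xs\<in>listset [UNIV, UNIV]. reval p xs = Some (xs ! 1 + Suc (xs ! 0))"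
    unfolding computable_on_def by blast
  then have p: "reval p [k, y] = Some (y + Suc k)" for k y
    by (auto simp: set_Cons_def)
  have "rec_nat (Some 0) (\<lambda>k r. Option.bind r (\<lambda>y. Some (Suc (y + k)))) n = Some (triangle n)" for n
    by (induction n) auto
  then have "computable1 UNIV triangle"
    unfolding computable_on_def
    by (intro exI[of _ "PrimRec Zero p"]) (auto simp: set_Cons_def p)
  from computable_on_comp1[OF this assms] show ?thesis by simp
qed

text \<open>Below its least zero \<open>f\<close> is defined and positive, which is exactly what
  \<open>Mu\<close> demands of the values that it passes.\<close>

lemma computable_on_Least:
  assumes f: "computable_on {n # xs |n xs. xs \<in> D} f"
    and ex: "\<And>xs. xs \<in> D \<Longrightarrow> \<exists>n. f (n # xs) = 0"
  shows "computable_on D (\<lambda>xs. LEAST n. f (n # xs) = 0)"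
proof -
  obtain p where p: "\<And>n xs. xs \<in> D \<Longrightarrow> reval p (n # xs) = Some (f (n # xs))"
    using f unfolding computable_on_def by blast
  have "reval (Mu p) xs = Some (LEAST n. f (n # xs) = 0)" if xs: "xs \<in> D" for xs
  proof -
    have "f ((LEAST n. f (n # xs) = 0) # xs) = 0"
      using ex[OF xs] by (rule LeastI_ex)
    moreover have "\<forall>k<(LEAST n. f (n # xs) = 0). \<exists>y. f (k # xs) = Suc y"
      using not_less_Least not0_implies_Suc by blast
    ultimately have "\<exists>n. f (n # xs) = 0 \<and> (\<forall>k<n. \<exists>y. f (k # xs) = Suc y)" by blast
    then show ?thesis by (simp add: p[OF xs])
  qed
  then show ?thesis unfolding computable_on_def by blast
qed

section \<open>The pairing function and its inverse\<close>

lemma computable_on_prod_encode: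
  assumes "computable_on D f" and "computable_on D g"
  shows "computable_on D (\<lambda>xs. prod_encode (f xs, g xs))"
  unfolding prod_encode_def using assms
  by (simp add: computable_on_add computable_on_triangle)

text \<open>The code of \<open>(a, b)\<close> is \<open>triangle (a + b) + a\<close>, so it lies in
  the block from \<open>triangle (a + b)\<close> up to, but excluding,
  \<open>triangle (Suc (a + b))\<close>. With truncated subtraction the condition says that the code
  is below \<open>triangle (Suc n)\<close>.\<close>

lemma triangle_root_prod_encode:
  "(LEAST n. Suc (prod_encode (a, b)) - triangle (Suc n) = 0) = a + b"
proof (rule Least_equality)
  show "Suc (prod_encode (a, b)) - triangle (Suc (a + b)) = 0"
    by (simp add: prod_encode_def)
next
  fix n
  assume n: "Suc (prod_encode (a, b)) - triangle (Suc n) = 0"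
  show "a + b \<le> n"
  proof (rule ccontr)
    assume "\<not> a + b \<le> n"
    moreover have "mono triangle"
      by (intro mono_iff_le_Suc[THEN iffD2]) simp
    ultimately have "triangle (Suc n) \<le> triangle (a + b)"
      by (intro monoD[of triangle]) auto
    then show False using n by (simp add: prod_encode_def)
  qed
qed

lemma computable_on_prod_decode:
  assumes "computable_on D f"
  shows "computable_on D (\<lambda>xs. fst (prod_decode (f xs)))"
    and "computable_on D (\<lambda>xs. snd (prod_decode (f xs)))"
proof -
  define r where "r z = (LEAST n. Suc z - triangle (Suc n) = 0)" for z
  have "computable_on (listset [UNIV])
    (\<lambda>xs. LEAST n. Suc ((n # xs) ! 1) - triangle (Suc ((n # xs) ! 0)) = 0)"
  proof (rule computable_on_Least)
    show "computable_on {n # xs |n xs. xs \<in> listset [UNIV]}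
      (\<lambda>xs. Suc (xs ! 1) - triangle (Suc (xs ! 0)))"
      by (intro computable_on_diff computable_on_Suc computable_on_triangle computable_on_nth)
         (auto simp: set_Cons_def)
    fix xs :: "nat list"
    \<comment> \<open>The number itself bounds the search, because \<open>triangle (Suc z)\<close>
      is \<open>triangle z + Suc z\<close>.\<close>
    show "\<exists>n. Suc ((n # xs) ! 1) - triangle (Suc ((n # xs) ! 0)) = 0"
      by (intro exI[of _ "xs ! 0"]) simp
  qed
  then have "computable1 UNIV r" by (simp add: r_def)
  from computable_on_comp1[OF this assms] have rf: "computable_on D (\<lambda>xs. r (f xs))" by simp
  \<comment> \<open>The block number \<open>r z\<close> is the sum of the two components, and the
    offset of \<open>z\<close> in its block is the first component.\<close>
  have z: "fst (prod_decode z) = z - triangle (r z)"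
    "snd (prod_decode z) = r z - (z - triangle (r z))" for z
  proof -
    obtain a b where ab: "z = prod_encode (a, b)"
      by (metis prod_decode_inverse surj_pair)
    then have "prod_decode z = (a, b)" by simp
    moreover have "r z = a + b"
      unfolding r_def ab by (rule triangle_root_prod_encode)
    moreover have "z = triangle (a + b) + a"
      by (simp add: ab prod_encode_def)
    ultimately show "fst (prod_decode z) = z - triangle (r z)"
      "snd (prod_decode z) = r z - (z - triangle (r z))" by auto
  qed
  show "computable_on D (\<lambda>xs. fst (prod_decode (f xs)))"
    and "computable_on D (\<lambda>xs. snd (prod_decode (f xs)))"
    unfolding z by (intro computable_on_diff computable_on_triangle assms rf)+
qed

section \<open>Indexings, operations and translations in terms of functions\<close>

lemma computable_from_to_imp:
  assumes "computable_from_to m A B f"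
  shows "computable_on A (\<lambda>xs. the (f xs))" and "\<And>xs. xs \<in> A \<Longrightarrow> the (f xs) \<in> B"
proof -
  obtain p where len: "\<And>xs. xs \<in> A \<Longrightarrow> length xs = m"
    and p: "\<And>xs. length xs = m \<Longrightarrow> f xs = reval p xs"
    and f: "\<And>xs. xs \<in> A \<Longrightarrow> \<exists>y\<in>B. f xs = Some y"
    using assms unfolding computable_from_to_def partial_computable_def by blast
  have "reval p xs = Some (the (f xs))" if "xs \<in> A" for xs
    using f[OF that] p[OF len[OF that]] by auto
  then show "computable_on A (\<lambda>xs. the (f xs))" unfolding computable_on_def by blast
  show "the (f xs) \<in> B" if "xs \<in> A" for xs
    using f[OF that] by auto
qed

text \<open>The program itself, run on all lists, serves as the partial function; only its values on
  \<open>A\<close> are controlled.\<close>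

lemma computable_on_imp:
  assumes "computable_on A g" and "A \<subseteq> {xs. length xs = m}" and "\<And>xs. xs \<in> A \<Longrightarrow> g xs \<in> B"
  obtains f where "computable_from_to m A B f" and "\<And>xs. xs \<in> A \<Longrightarrow> f xs = Some (g xs)"
proof -
  obtain p where p: "\<forall>xs\<in>A. reval p xs = Some (g xs)"
    using assms(1) unfolding computable_on_def by blast
  show thesis
  proof
    show "computable_from_to m A B (reval p)"
      using p assms(2,3) by (auto simp: computable_from_to_def partial_computable_def)
    show "\<And>xs. xs \<in> A \<Longrightarrow> reval p xs = Some (g xs)" using p by blast
  qed
qed

lemma effectively_enumerable_iff:
  "effectively_enumerable A \<longleftrightarrow> A = {} \<or> (\<exists>e. computable1 UNIV e \<and> range e = A)"
proof -
  have "(\<exists>f. computable_from_to 1 {xs. length xs = 1} UNIV f \<and> A = range (\<lambda>n. the (f [n]))) \<longleftrightarrow>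
    (\<exists>e. computable1 UNIV e \<and> range e = A)" (is "?l = ?r")
  proof
    assume ?l
    then obtain f where f: "computable_from_to 1 (listset [UNIV]) UNIV f" "A = range (\<lambda>n. the (f [n]))"
      unfolding listset1_UNIV by blast
    have "computable1 UNIV (\<lambda>n. the (f [n]))"
      by (rule computable_on_cong[OF computable_from_to_imp(1)[OF f(1)]]) (auto simp: set_Cons_def)
    then show ?r using f(2) by (intro exI[of _ "\<lambda>n. the (f [n])"]) simp
  next
    assume ?r
    then obtain e where e: "computable1 UNIV e" "range e = A" by blast
    obtain f where f: "computable_from_to 1 (listset [UNIV]) UNIV f"
      "\<And>xs. xs \<in> listset [UNIV] \<Longrightarrow> f xs = Some (e (xs ! 0))"
      by (rule computable_on_imp[OF e(1), of 1 UNIV]) (auto simp: set_Cons_def)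
    have "the (f [n]) = e n" for n using f(2)[of "[n]"] by (simp add: set_Cons_def)
    then show ?l using e f(1) unfolding listset1_UNIV by auto
  qed
  then show ?thesis unfolding effectively_enumerable_def by simp
qed

lemma indexing_iff:
  "indexing E i \<longleftrightarrow> effectively_enumerable (dom i) \<and> ran i = E \<and>
     computable2 (dom i) (dom i) (\<lambda>x y. if i x = i y then 1 else 0)"
proof -
  have "(\<exists>eq. computable_from_to 2 (listset [dom i, dom i]) {0, 1} eq \<and>
           (\<forall>x\<in>dom i. \<forall>y\<in>dom i. eq [x, y] = Some (if i x = i y then 1 else 0))) \<longleftrightarrow>
     computable2 (dom i) (dom i) (\<lambda>x y. if i x = i y then 1 else 0)" (is "?l = ?r")
  proof
    assume ?l
    then obtain eq where eq: "computable_from_to 2 (listset [dom i, dom i]) {0, 1} eq"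
      "\<forall>x\<in>dom i. \<forall>y\<in>dom i. eq [x, y] = Some (if i x = i y then 1 else 0)"
      by blast
    show ?r
      by (rule computable_on_cong[OF computable_from_to_imp(1)[OF eq(1)]])
         (unfold listset2, elim bexE, simp add: eq(2))
  next
    assume r: ?r
    obtain f where f: "computable_from_to 2 (listset [dom i, dom i]) {0, 1} f"
      "\<And>xs. xs \<in> listset [dom i, dom i] \<Longrightarrow> f xs = Some (if i (xs ! 0) = i (xs ! 1) then 1 else 0)"
      by (rule computable_on_imp[OF r, of 2 "{0, 1}"]) (auto simp: set_Cons_def)
    have "f [x, y] = Some (if i x = i y then 1 else 0)" if "x \<in> dom i" "y \<in> dom i" for x y
      using f(2)[of "[x, y]"] that by (simp add: listset2 del: listset.simps)
    then show ?l using f(1) by blast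
  qed
  then show ?thesis unfolding indexing_def by simp
qed

text \<open>The three sorts may have different types, so scalars and vectors need no tags here. That
  \<open>g x y\<close> is a code in \<open>i3\<close> is part of the equation, whose right side is
  not \<open>None\<close>.\<close>

definition computable_op ::
    "(nat \<rightharpoonup> 'a) \<Rightarrow> (nat \<rightharpoonup> 'b) \<Rightarrow> (nat \<rightharpoonup> 'c) \<Rightarrow> ('a \<Rightarrow> 'b \<Rightarrow> 'c) \<Rightarrow> bool" where
  "computable_op i1 i2 i3 F \<longleftrightarrow>
     (\<exists>g. computable2 (dom i1) (dom i2) g \<and>
          (\<forall>x a y b. i1 x = Some a \<longrightarrow> i2 y = Some b \<longrightarrow> i3 (g x y) = Some (F a b)))"

definition translatable :: "(nat \<rightharpoonup> 'a) \<Rightarrow> (nat \<rightharpoonup> 'a) \<Rightarrow> bool" where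
  "translatable i' i \<longleftrightarrow> (\<exists>h. computable1 (dom i') h \<and> (\<forall>x\<in>dom i'. i' x = i (h x)))"

text \<open>All operations of fields and vector spaces are binary, so this instance of
  \<open>computable_rel\<close> covers them.\<close>

lemma computable_rel_iff:
  "computable_rel [i1, i2] i3 f \<longleftrightarrow> computable_op i1 i2 i3 (\<lambda>a b. f [a, b])"
proof
  assume "computable_rel [i1, i2] i3 f"
  then obtain f' where f': "computable_from_to 2 (listset [dom i1, dom i2]) (dom i3) f'"
    "\<forall>xs\<in>listset [dom i1, dom i2]. i3 (the (f' xs)) = Some (f (map2 (\<lambda>i x. the (i x)) [i1, i2] xs))"
    unfolding computable_rel_def by (auto simp: numeral_2_eq_2 simp del: listset.simps)
  have "computable2 (dom i1) (dom i2) (\<lambda>x y. the (f' [x, y]))"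
    by (rule computable_on_cong[OF computable_from_to_imp(1)[OF f'(1)]]) (auto simp: set_Cons_def)
  moreover have "i3 (the (f' [x, y])) = Some (f [a, b])" if "i1 x = Some a" "i2 y = Some b" for x y a b
    using f'(2)[rule_format, of "[x, y]"] that by (simp add: domI listset2 del: listset.simps)
  ultimately show "computable_op i1 i2 i3 (\<lambda>a b. f [a, b])"
    unfolding computable_op_def by (intro exI[of _ "\<lambda>x y. the (f' [x, y])"]) simp
next
  assume "computable_op i1 i2 i3 (\<lambda>a b. f [a, b])"
  then obtain g where g: "computable2 (dom i1) (dom i2) g"
    "\<And>x a y b. i1 x = Some a \<Longrightarrow> i2 y = Some b \<Longrightarrow> i3 (g x y) = Some (f [a, b])"
    unfolding computable_op_def by blast
  obtain f' where f': "computable_from_to 2 (listset [dom i1, dom i2]) (dom i3) f'"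
      "\<And>xs. xs \<in> listset [dom i1, dom i2] \<Longrightarrow> f' xs = Some (g (xs ! 0) (xs ! 1))"
    by (rule computable_on_imp[OF g(1), of 2 "dom i3"]) (use g(2) in \<open>fastforce simp: set_Cons_def\<close>)+
  have "i3 (the (f' xs)) = Some (f (map2 (\<lambda>i x. the (i x)) [i1, i2] xs))"
    if xs: "xs \<in> listset [dom i1, dom i2]" for xs
  proof -
    obtain x y a b where *: "xs = [x, y]" "i1 x = Some a" "i2 y = Some b"
      using xs unfolding listset2 by blast
    with f'(2)[OF xs] g(2)[OF *(2,3)] show ?thesis by simp
  qed
  then show "computable_rel [i1, i2] i3 f"
    using f'(1) unfolding computable_rel_def by (intro exI[of _ f']) (simp add: numeral_2_eq_2)
qed

lemma translatable_iff:
  "(\<exists>h. computable_from_to 1 (listset [dom i']) (dom i) h \<and> (\<forall>x\<in>dom i'. i' x = i (the (h [x]))))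
     \<longleftrightarrow> translatable i' i" (is "?l = ?r")
proof
  assume ?l
  then obtain h where h: "computable_from_to 1 (listset [dom i']) (dom i) h"
    "\<forall>x\<in>dom i'. i' x = i (the (h [x]))" by blast
  have "computable1 (dom i') (\<lambda>x. the (h [x]))"
    by (rule computable_on_cong[OF computable_from_to_imp(1)[OF h(1)]]) (auto simp: set_Cons_def)
  then show ?r using h(2) unfolding translatable_def
    by (intro exI[of _ "\<lambda>x. the (h [x])"]) simp
next
  assume ?r
  then obtain h where h: "computable1 (dom i') h" "\<forall>x\<in>dom i'. i' x = i (h x)"
    unfolding translatable_def by blast
  have *: "h x \<in> dom i" if "x \<in> dom i'" for x
    using h(2) that by (metis domIff)
  obtain f where f: "computable_from_to 1 (listset [dom i']) (dom i) f"
      "\<And>xs. xs \<in> listset [dom i'] \<Longrightarrow> f xs = Some (h (xs ! 0))"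
  proof (rule computable_on_imp[OF h(1), of 1 "dom i"])
    show "h (xs ! 0) \<in> dom i" if "xs \<in> listset [dom i']" for xs
      using that unfolding listset1 by (elim bexE) (simp add: *)
  qed (auto simp: set_Cons_def)
  have "f [x] = Some (h x)" if "x \<in> dom i'" for x
    using f(2)[of "[x]"] that by (simp add: listset1 del: listset.simps)
  then show ?l using f(1) h(2) by (intro exI[of _ f]) simp
qed

section \<open>Renaming the values of indexings by injections\<close>

lemma dom_map_option_comp [simp]: "dom (map_option f \<circ> i) = dom i"
  by (auto simp: dom_def)

text \<open>The codes stay the same and injectivity preserves which of them denote equal elements,
  so the same equality test works. This serves both the tags \<open>Inl\<close> and
  \<open>Inr\<close> and the automorphisms of the space.\<close>

lemma indexing_map_option:
  assumes "inj f"
  shows "indexing (f ` E) (map_option f \<circ> i) \<longleftrightarrow> indexing E i"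
proof -
  have "ran (map_option f \<circ> i) = f ` ran i" by (force simp: ran_def)
  then have "ran (map_option f \<circ> i) = f ` E \<longleftrightarrow> ran i = E"
    using inj_image_eq_iff[OF assms] by metis
  moreover have "map_option f (i x) = map_option f (i y) \<longleftrightarrow> i x = i y" for x y
    using inj_eq[OF option.inj_map[OF assms]] .
  ultimately show ?thesis by (simp add: indexing_iff del: listset.simps)
qed

text \<open>The same function on codes witnesses both sides, since \<open>F\<close> is only
  evaluated at images under \<open>f\<close> and \<open>g\<close>.\<close>

lemma computable_op_map_option:
  assumes "inj h" and "\<And>a b. F (f a) (g b) = h (G a b)"
  shows "computable_op (map_option f \<circ> i1) (map_option g \<circ> i2) (map_option h \<circ> i3) F \<longleftrightarrow>
         computable_op i1 i2 i3 G"
proof -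
  have "(\<forall>x c y d. map_option f (i1 x) = Some c \<longrightarrow> map_option g (i2 y) = Some d \<longrightarrow>
          map_option h (i3 (r x y)) = Some (F c d)) \<longleftrightarrow>
        (\<forall>x a y b. i1 x = Some a \<longrightarrow> i2 y = Some b \<longrightarrow> i3 (r x y) = Some (G a b))" for r
    using assms by (simp add: map_option_eq_Some) (metis injD)
  then show ?thesis unfolding computable_op_def by (simp del: listset.simps)
qed

lemma translatable_map_option:
  assumes "inj f"
  shows "translatable (map_option f \<circ> i') (map_option f \<circ> i) \<longleftrightarrow> translatable i' i"
  using inj_eq[OF option.inj_map[OF assms]] unfolding translatable_def by (simp del: listset.simps)

lemma list_all2_singleton:
  "list_all2 P [a] ys \<longleftrightarrow> (\<exists>y. ys = [y] \<and> P a y)"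
  by (auto simp: list_all2_Cons1)

lemma indexing_range_imp:
  assumes "indexing (range f) J" and "inj f"
  obtains j where "J = map_option f \<circ> j" and "indexing UNIV j"
proof
  \<comment> \<open>All values of \<open>J\<close> lie in \<open>range f\<close>, where
    \<open>f\<close> undoes \<open>inv f\<close>.\<close>
  show eq: "J = map_option f \<circ> (map_option (inv f) \<circ> J)"
  proof
    fix x
    show "J x = (map_option f \<circ> (map_option (inv f) \<circ> J)) x"
    proof (cases "J x")
      case (Some u)
      then have "u \<in> range f" using assms(1) by (auto simp: indexing_iff ran_def)
      then show ?thesis using Some by (simp add: f_inv_into_f)
    qed simp
  qed
  show "indexing UNIV (map_option (inv f) \<circ> J)"
    using assms(1) eq indexing_map_option[OF assms(2), of UNIV] by metis
qed

section \<open>Admissibility and stability without the sum type\<close>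

definition field_indexing :: "(nat \<rightharpoonup> 'k::field) \<Rightarrow> bool" where
  "field_indexing j \<longleftrightarrow> indexing UNIV j \<and> computable_op j j j (+) \<and> computable_op j j j (*)"

text \<open>Only the conditions on the sort of vectors are collected; keeping
  \<open>field_indexing j\<close> apart allows \<open>i\<close> to vary over a fixed
  \<open>j\<close>.\<close>

definition vector_indexing ::
    "('k::field \<Rightarrow> 'e::ab_group_add \<Rightarrow> 'e) \<Rightarrow> (nat \<rightharpoonup> 'k) \<Rightarrow> (nat \<rightharpoonup> 'e) \<Rightarrow> bool" where
  "vector_indexing scale j i \<longleftrightarrow>
     indexing UNIV i \<and> computable_op i i i (+) \<and> computable_op j i i scale"

lemma admissible_field_iff:
  "admissible_indexing field_structure js \<longleftrightarrow> (\<exists>j. js = [j] \<and> field_indexing j)"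
  by (auto simp: admissible_indexing_def field_structure_def field_indexing_def
      list_all2_singleton computable_rel_iff)

text \<open>An indexing of \<open>range Inl\<close> or \<open>range Inr\<close> is a tagged indexing
  of the untagged type, and the four operations merely strip and restore tags.\<close>

lemma admissible_vector_iff:
  "admissible_indexing (vector_space_structure scale) js \<longleftrightarrow>
     (\<exists>j i. js = [map_option Inl \<circ> j, map_option Inr \<circ> i] \<and> field_indexing j \<and>
            vector_indexing scale j i)" (is "?l = ?r")
proof -
  have *: "admissible_indexing (vector_space_structure scale) [map_option Inl \<circ> j, map_option Inr \<circ> i]
      \<longleftrightarrow> field_indexing j \<and> vector_indexing scale j i" for j i
  proof -
    have "computable_op (map_option Inl \<circ> j) (map_option Inl \<circ> j) (map_option Inl \<circ> j)
        (\<lambda>a b. Inl (projl a + projl b)) \<longleftrightarrow> computable_op j j j (+)"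
      "computable_op (map_option Inl \<circ> j) (map_option Inl \<circ> j) (map_option Inl \<circ> j)
        (\<lambda>a b. Inl (projl a * projl b)) \<longleftrightarrow> computable_op j j j (*)"
      "computable_op (map_option Inr \<circ> i) (map_option Inr \<circ> i) (map_option Inr \<circ> i)
        (\<lambda>a b. Inr (projr a + projr b)) \<longleftrightarrow> computable_op i i i (+)"
      "computable_op (map_option Inl \<circ> j) (map_option Inr \<circ> i) (map_option Inr \<circ> i)
        (\<lambda>a b. Inr (scale (projl a) (projr b))) \<longleftrightarrow> computable_op j i i scale"
      by (rule computable_op_map_option; simp)+
    then show ?thesis
      using indexing_map_option[of Inl UNIV j] indexing_map_option[of Inr UNIV i]
      by (simp add: admissible_indexing_def vector_space_structure_def field_indexing_def
          vector_indexing_def computable_rel_iff) blast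
  qed
  show ?thesis
  proof
    assume l: ?l
    then obtain J I where js: "js = [J, I]" "indexing (range Inl) J" "indexing (range Inr) I"
      by (auto simp: admissible_indexing_def vector_space_structure_def list_all2_Cons1)
    obtain j where j: "J = map_option Inl \<circ> j"
      by (rule indexing_range_imp[OF js(2)]) simp_all
    obtain i where i: "I = map_option Inr \<circ> i"
      by (rule indexing_range_imp[OF js(3)]) simp_all
    show ?r using l unfolding js(1) j i * by blast
  qed (auto simp: *)
qed

lemma stable_field_iff:
  "stable_computability (field_structure :: 'k::field many_sorted) \<longleftrightarrow>
     (\<exists>j::nat \<rightharpoonup> 'k. field_indexing j) \<and>
     (\<forall>j j'::nat \<rightharpoonup> 'k. field_indexing j \<and> field_indexing j' \<longrightarrow> translatable j' j)"
proof -
  have "length (sorts (field_structure :: 'k many_sorted)) = 1" by (simp add: field_structure_def)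
  moreover have "(\<forall>js js'. (\<exists>j. js = [j] \<and> P j) \<and> (\<exists>j. js' = [j] \<and> P j) \<longrightarrow> Q js js') \<longleftrightarrow>
    (\<forall>j j'. P j \<and> P j' \<longrightarrow> Q [j] [j'])" for P :: "(nat \<rightharpoonup> 'k) \<Rightarrow> bool" and Q
    by blast
  ultimately show ?thesis
    unfolding stable_computability_def translatable_iff admissible_field_iff by simp
qed

lemma stable_vector_iff:
  fixes scale :: "'k::field \<Rightarrow> 'e::ab_group_add \<Rightarrow> 'e"
  shows
  "stable_computability (vector_space_structure scale) \<longleftrightarrow>
     (\<exists>j i. field_indexing j \<and> vector_indexing scale j i) \<and>
     (\<forall>j i j' i'. field_indexing j \<and> vector_indexing scale j i \<and>
        field_indexing j' \<and> vector_indexing scale j' i' \<longrightarrow> translatable j' j \<and> translatable i' i)"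
proof -
  have len: "(\<forall>k<length (sorts (vector_space_structure scale)). P k) \<longleftrightarrow> P 0 \<and> P 1" for P
    by (auto simp: vector_space_structure_def less_Suc_eq numeral_2_eq_2)
  have "(\<forall>js js'. (\<exists>j i. js = G j i \<and> P j \<and> R j i) \<and> (\<exists>j i. js' = G j i \<and> P j \<and> R j i) \<longrightarrow> Q js js') \<longleftrightarrow>
    (\<forall>j i j' i'. P j \<and> R j i \<and> P j' \<and> R j' i' \<longrightarrow> Q (G j i) (G j' i'))"
    for G :: "(nat \<rightharpoonup> 'k) \<Rightarrow> (nat \<rightharpoonup> 'e) \<Rightarrow> (nat \<rightharpoonup> 'k + 'e) list" and P R Q
    by blast
  then show ?thesis
    unfolding stable_computability_def translatable_iff admissible_vector_iff len
    by (simp add: translatable_map_option)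
qed

section \<open>Finite-dimensional spaces\<close>

text \<open>As \<open>E\<close> is nonempty, so is \<open>dom i\<close>, which rules out the
  degenerate case of effective enumerability.\<close>

lemma indexing_enum:
  assumes "indexing E i" and "E \<noteq> {}"
  obtains e where "computable1 UNIV e" and "range e = dom i"
proof -
  have "dom i \<noteq> {}" using assms by (auto simp: indexing_iff ran_def)
  then show thesis
    using assms that by (auto simp: indexing_iff effectively_enumerable_iff simp del: listset.simps)
qed

lemma indexing_code:
  assumes "indexing E i" and "v \<in> E"
  obtains c where "i c = Some v"
  using assms by (auto simp: indexing_iff ran_def)

lemma computable_op_fun:
  assumes "computable_op i1 i2 i3 F"
  obtains g where "computable2 (dom i1) (dom i2) g"
    and "\<And>x a y b. i1 x = Some a \<Longrightarrow> i2 y = Some b \<Longrightarrow> i3 (g x y) = Some (F a b)"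
  using assms unfolding computable_op_def by blast

text \<open>Codes of the same vectors in two indexings can be enumerated in parallel, because they are
  built from codes of scalars and of basis vectors by the same operations.\<close>

lemma parallel_enumeration:
  fixes scale :: "'k::field \<Rightarrow> 'e::ab_group_add \<Rightarrow> 'e"
  assumes "vector_space scale" and "finite S"
    and j': "indexing UNIV j'" and tr: "translatable j' j"
    and i: "vector_indexing scale j i" and i': "vector_indexing scale j' i'"
  shows "\<exists>e' e. computable1 UNIV e' \<and> computable1 UNIV e \<and>
    (\<forall>n. \<exists>v. i' (e' n) = Some v \<and> i (e n) = Some v) \<and>
    (\<forall>v\<in>module.span scale S. \<exists>n. i' (e' n) = Some v)"
proof -
  interpret vector_space scale by fact
  have idx: "indexing UNIV i" "indexing UNIV i'" using i i' by (auto simp: vector_indexing_def)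
  show ?thesis using \<open>finite S\<close>
  proof (induction S)
    case empty
    obtain c c' where "i c = Some 0" "i' c' = Some 0"
      using indexing_code[OF idx(1)] indexing_code[OF idx(2)] UNIV_I by metis
    then show ?case
      by (intro exI[of _ "\<lambda>_. c'"] exI[of _ "\<lambda>_. c"]) (simp add: computable_on_const)
  next
    case (insert b S)
    then obtain e' e where e: "computable1 UNIV e'" "computable1 UNIV e"
      "\<And>n. \<exists>v. i' (e' n) = Some v \<and> i (e n) = Some v"
      "\<And>v. v \<in> span S \<Longrightarrow> \<exists>n. i' (e' n) = Some v" by blast
    obtain c c' where c: "i c = Some b" "i' c' = Some b"
      using indexing_code[OF idx(1)] indexing_code[OF idx(2)] UNIV_I by metis
    \<comment> \<open>\<open>k\<close> runs through all codes of scalars in \<open>j'\<close>, and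
      \<open>t\<close> turns each of them into a code of the same scalar in
      \<open>j\<close>.\<close>
    obtain k where k: "computable1 UNIV k" "range k = dom j'"
      using indexing_enum[OF j'] by blast
    obtain t where t: "computable1 (dom j') t" "\<And>x. x \<in> dom j' \<Longrightarrow> j' x = j (t x)"
      using tr unfolding translatable_def by blast
    have ops: "computable_op i i i (+)" "computable_op j i i scale"
      "computable_op i' i' i' (+)" "computable_op j' i' i' scale"
      using i i' by (auto simp: vector_indexing_def)
    obtain a where a: "computable2 (dom i) (dom i) a"
      "\<And>x u y v. i x = Some u \<Longrightarrow> i y = Some v \<Longrightarrow> i (a x y) = Some (u + v)"
      by (rule computable_op_fun[OF ops(1)]) blast
    obtain s where s: "computable2 (dom j) (dom i) s"
      "\<And>x u y v. j x = Some u \<Longrightarrow> i y = Some v \<Longrightarrow> i (s x y) = Some (scale u v)"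
      by (rule computable_op_fun[OF ops(2)]) blast
    obtain a' where a': "computable2 (dom i') (dom i') a'"
      "\<And>x u y v. i' x = Some u \<Longrightarrow> i' y = Some v \<Longrightarrow> i' (a' x y) = Some (u + v)"
      by (rule computable_op_fun[OF ops(3)]) blast
    obtain s' where s': "computable2 (dom j') (dom i') s'"
      "\<And>x u y v. j' x = Some u \<Longrightarrow> i' y = Some v \<Longrightarrow> i' (s' x y) = Some (scale u v)"
      by (rule computable_op_fun[OF ops(4)]) blast
    \<comment> \<open>A position \<open>n\<close> is read as a pair: the position of a coefficient
      for \<open>b\<close> and a position in the enumerations for \<open>S\<close>.\<close>
    define l m where "l n = fst (prod_decode n)" and "m n = snd (prod_decode n)" for n
    define f' where "f' n = a' (s' (k (l n)) c') (e' (m n))" for n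
    define f where "f n = a (s (t (k (l n))) c) (e (m n))" for n
    have val: "\<exists>u v. j' (k p) = Some u \<and> j (t (k p)) = Some u \<and> i' (e' q) = Some v \<and> i (e q) = Some v"
      for p q
    proof -
      have "k p \<in> dom j'" using k(2) by blast
      with t(2)[OF this] e(3)[of q] show ?thesis by (metis domD)
    qed
    have nth: "computable1 UNIV (\<lambda>x. x)"
      by (rule computable_on_nth) (auto simp: set_Cons_def)
    note lm = computable_on_prod_decode[OF nth, folded l_def m_def]
    have kl: "computable1 UNIV (\<lambda>n. k (l n))"
      by (rule computable_on_comp1[OF k(1) lm(1)]) simp
    have "computable1 UNIV (\<lambda>n. s' (k (l n)) c')"
      by (rule computable_on_comp2[OF s'(1) kl computable_on_const]) (use k c in auto)
    moreover have "computable1 UNIV (\<lambda>n. e' (m n))"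
      by (rule computable_on_comp1[OF e(1) lm(2)]) simp
    ultimately have f'1: "computable1 UNIV f'"
      unfolding f'_def by (rule computable_on_comp2[OF a'(1)]) (metis val s'(2) c(2) domI)+
    have "computable1 UNIV (\<lambda>n. t (k (l n)))"
      by (rule computable_on_comp1[OF t(1) kl]) (use k in auto)
    then have "computable1 UNIV (\<lambda>n. s (t (k (l n))) c)"
      by (rule computable_on_comp2[OF s(1) _ computable_on_const]) (metis val c(1) domI)+
    moreover have "computable1 UNIV (\<lambda>n. e (m n))"
      by (rule computable_on_comp1[OF e(2) lm(2)]) simp
    ultimately have f1: "computable1 UNIV f"
      unfolding f_def by (rule computable_on_comp2[OF a(1)]) (metis val s(2) c(1) domI)+
    have f2: "\<exists>v. i' (f' n) = Some v \<and> i (f n) = Some v" for n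
    proof -
      obtain u v where uv: "j' (k (l n)) = Some u" "j (t (k (l n))) = Some u"
        "i' (e' (m n)) = Some v" "i (e (m n)) = Some v" using val by blast
      show ?thesis unfolding f'_def f_def
        using a'(2)[OF s'(2)[OF uv(1) c(2)] uv(3)] a(2)[OF s(2)[OF uv(2) c(1)] uv(4)] by blast
    qed
    have f3: "\<exists>n. i' (f' n) = Some v" if v: "v \<in> span (insert b S)" for v
    proof -
      \<comment> \<open>Here \<open>u\<close> is the coefficient of \<open>b\<close>; the remainder
        is listed by the induction hypothesis.\<close>
      obtain u where "v - scale u b \<in> span S" using v unfolding span_breakdown_eq by blast
      then obtain q where q: "i' (e' q) = Some (v - scale u b)" using e(4) by blast
      obtain x where x: "j' x = Some u" using indexing_code[OF j'] by blast
      then obtain p where "x = k p" using k(2) by blast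
      with x q have "i' (f' (prod_encode (p, q))) = Some (scale u b + (v - scale u b))"
        unfolding f'_def l_def m_def by (simp add: a'(2) s'(2) c(2))
      then show ?thesis by auto
    qed
    show ?case
      by (intro exI[of _ f'] exI[of _ f]) (use f'1 f1 f2 f3 in \<open>simp del: listset.simps\<close>)
  qed
qed

text \<open>A code in \<open>i'\<close> is compared with the \<open>i'\<close>-codes of the parallel
  enumeration until the equality test of \<open>i'\<close> succeeds; the \<open>i\<close>-code at
  that position is the translation. The search ends because the basis spans the space.\<close>

lemma vector_translatable:
  assumes fin: "finite_dimensional_vector_space scale B"
    and "indexing UNIV j'" and "translatable j' j"
    and "vector_indexing scale j i" and i': "vector_indexing scale j' i'"
  shows "translatable i' i"
proof -
  interpret finite_dimensional_vector_space scale B by fact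
  obtain e' e where e: "computable1 UNIV e'" "computable1 UNIV e"
    "\<And>n. \<exists>v. i' (e' n) = Some v \<and> i (e n) = Some v" "\<And>v. \<exists>n. i' (e' n) = Some v"
    using parallel_enumeration[OF vector_space_axioms finite_Basis assms(2-5)] span_Basis
    by auto
  define eq where "eq x y = (if i' x = i' y then 1 else 0 :: nat)" for x y
  \<comment> \<open>Subtracting the test from 1 turns success into a zero, the form that
    \<open>computable_on_Least\<close> searches for.\<close>
  define h where "h x = e (LEAST n. 1 - eq (e' n) x = 0)" for x
  have ex: "\<exists>n. 1 - eq (e' n) x = 0" if x: "x \<in> dom i'" for x
  proof -
    obtain v where v: "i' x = Some v" using x by blast
    obtain n where "i' (e' n) = Some v" using e(4) by blast
    with v show ?thesis by (intro exI[of _ n]) (simp add: eq_def)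
  qed
  have "computable_on {n # xs |n xs. xs \<in> listset [dom i']} (\<lambda>xs. 1 - eq (e' (xs ! 0)) (xs ! 1))"
  proof (intro computable_on_diff computable_on_const)
    have eq: "computable2 (dom i') (dom i') eq"
      using i' by (simp add: vector_indexing_def indexing_iff eq_def del: listset.simps)
    have "computable_on {n # xs |n xs. xs \<in> listset [dom i']} (\<lambda>xs. e' (xs ! 0))"
      by (rule computable_on_comp1[OF e(1) computable_on_nth]) auto
    then show "computable_on {n # xs |n xs. xs \<in> listset [dom i']} (\<lambda>xs. eq (e' (xs ! 0)) (xs ! 1))"
    proof (rule computable_on_comp2[OF eq _ computable_on_nth])
      show "e' (xs ! 0) \<in> dom i'" for xs using e(3) by blast
    qed (auto simp: set_Cons_def)
  qed
  then have "computable_on (listset [dom i']) (\<lambda>xs. LEAST n. 1 - eq (e' ((n # xs) ! 0)) ((n # xs) ! 1) = 0)"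
  proof (rule computable_on_Least)
    fix xs assume "xs \<in> listset [dom i']"
    then obtain x where x: "xs = [x]" "x \<in> dom i'" unfolding listset1 by blast
    show "\<exists>n. 1 - eq (e' ((n # xs) ! 0)) ((n # xs) ! 1) = 0"
      using ex[OF x(2)] by (simp add: x(1))
  qed
  then have "computable1 (dom i') (\<lambda>x. LEAST n. 1 - eq (e' n) x = 0)" by simp
  then have "computable1 (dom i') h"
    unfolding h_def by (rule computable_on_comp1[OF e(2)]) simp
  moreover have "i' x = i (h x)" if "x \<in> dom i'" for x
  proof -
    define n where "n = (LEAST n. 1 - eq (e' n) x = 0)"
    have "1 - eq (e' n) x = 0" unfolding n_def using ex[OF that] by (rule LeastI_ex)
    then have "i' (e' n) = i' x" by (simp add: eq_def split: if_splits)
    then show ?thesis using e(3)[of n] by (auto simp: h_def n_def)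
  qed
  ultimately show ?thesis unfolding translatable_def by blast
qed

text \<open>A vector of \<open>span (insert b S)\<close> is coded by the pair of its coefficient at \<open>b\<close> and the rest.\<close>

lemma ex_span_indexing:
  fixes scale :: "'k::field \<Rightarrow> 'e::ab_group_add \<Rightarrow> 'e"
  assumes "vector_space scale" and j: "field_indexing j"
    and "finite S" and "\<not> module.dependent scale S"
  shows "\<exists>i. indexing (module.span scale S) i \<and> computable_op i i i (+) \<and> computable_op j i i scale"
proof -
  interpret vector_space scale by fact
  show ?thesis using \<open>finite S\<close> \<open>independent S\<close>
  proof (induction S)
    case empty
    \<comment> \<open>Every number is a code of the only vector of the zero space.\<close>
    define i :: "nat \<rightharpoonup> 'e" where "i = (\<lambda>_. Some 0)"
    have "computable1 UNIV (\<lambda>x. x)"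
      by (rule computable_on_nth) (auto simp: set_Cons_def)
    then have "effectively_enumerable UNIV"
      unfolding effectively_enumerable_iff by (intro disjI2 exI[of _ "\<lambda>x. x"]) simp
    then have "indexing {0} i"
      by (simp add: indexing_iff i_def dom_def ran_def computable_on_const)
    moreover have "computable_op i i i (+)" "computable_op j i i scale"
      unfolding computable_op_def i_def
      by (intro exI[of _ "\<lambda>_ _. 0"]; simp add: computable_on_const)+
    ultimately show ?case by auto
  next
    case (insert b S)
    then have b: "b \<notin> span S" and "independent S"
      by (simp_all add: independent_insert)
    with insert obtain i where i: "indexing (span S) i" "computable_op i i i (+)"
      "computable_op j i i scale" by blast
    have ran_i: "ran i = span S" using i(1) by (simp add: indexing_iff)
    have j_add: "computable_op j j j (+)" and j_mult: "computable_op j j j (*)"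
      using j by (simp_all add: field_indexing_def)
    have ran_j: "ran j = UNIV" using j by (simp add: field_indexing_def indexing_iff)
    define l m where "l n = fst (prod_decode n)" and "m n = snd (prod_decode n)" for n
    have lm: "l (prod_encode (p, q)) = p" "m (prod_encode (p, q)) = q" for p q
      by (simp_all add: l_def m_def)
    define i' where
      "i' n = Option.bind (j (l n)) (\<lambda>u. Option.bind (i (m n)) (\<lambda>v. Some (scale u b + v)))" for n
    have i'_Some: "i' n = Some w \<longleftrightarrow>
        (\<exists>u v. j (l n) = Some u \<and> i (m n) = Some v \<and> w = scale u b + v)" for n w
      by (auto simp: i'_def bind_eq_Some_conv)
    have dom_i': "n \<in> dom i' \<longleftrightarrow> l n \<in> dom j \<and> m n \<in> dom i" for n
      unfolding dom_def by (auto simp: i'_Some)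
    have clm: "computable_on D (\<lambda>xs. l (f xs))" "computable_on D (\<lambda>xs. m (f xs))"
      if "computable_on D f" for D f
      using computable_on_prod_decode[OF that] by (simp_all add: l_def m_def)
    have nth: "computable_on (listset [A, B]) (\<lambda>xs. xs ! 0)"
      "computable_on (listset [A, B]) (\<lambda>xs. xs ! 1)" for A B
      by (rule computable_on_nth; auto simp: set_Cons_def)+
    have "ran i' = span (insert b S)"
    proof -
      have "w \<in> ran i' \<longleftrightarrow> (\<exists>u. \<exists>v\<in>ran i. w = scale u b + v)" for w
      proof
        assume "w \<in> ran i'"
        then show "\<exists>u. \<exists>v\<in>ran i. w = scale u b + v" by (auto simp: ran_def i'_Some)
      next
        assume "\<exists>u. \<exists>v\<in>ran i. w = scale u b + v"
        then obtain u v q where uv: "i q = Some v" "w = scale u b + v" by (auto simp: ran_def)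
        obtain p where "j p = Some u" using ran_j by (auto simp: ran_def)
        with uv have "i' (prod_encode (p, q)) = Some w" by (auto simp: i'_Some lm)
        then show "w \<in> ran i'" by (rule ranI)
      qed
      moreover have "w \<in> span (insert b S) \<longleftrightarrow> (\<exists>u. \<exists>v\<in>span S. w = scale u b + v)" for w
        unfolding span_breakdown_eq by (metis add_diff_cancel_left' diff_add_cancel add.commute)
      ultimately show ?thesis using ran_i by auto
    qed
    moreover have "effectively_enumerable (dom i')"
    proof -
      obtain p where p: "computable1 UNIV p" "range p = dom j"
        using j indexing_enum unfolding field_indexing_def by (metis UNIV_not_empty)
      obtain q where q: "computable1 UNIV q" "range q = dom i"
        using indexing_enum[OF i(1)] span_zero by blast
      \<comment> \<open>Running through all pairs of positions lists all pairs of codes.\<close>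
      define e where "e n = prod_encode (p (l n), q (m n))" for n
      have "computable1 UNIV (\<lambda>x. x)"
        by (rule computable_on_nth) (auto simp: set_Cons_def)
      then have "computable1 UNIV e"
        unfolding e_def
        by (intro computable_on_prod_encode computable_on_comp1[OF p(1)] computable_on_comp1[OF q(1)] clm)
           auto
      moreover have "range e = dom i'"
      proof (intro equalityI subsetI)
        fix n assume "n \<in> range e"
        then show "n \<in> dom i'" unfolding dom_i' using p(2) q(2) by (auto simp: e_def lm)
      next
        fix n assume "n \<in> dom i'"
        then obtain x y where "l n = p x" "m n = q y" unfolding dom_i' using p(2) q(2) by blast
        then have "n = e (prod_encode (x, y))"
          unfolding e_def lm by (metis l_def m_def prod.collapse prod_decode_inverse)
        then show "n \<in> range e" by blast
      qed
      ultimately show ?thesis unfolding effectively_enumerable_iff by blast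
    qed
    moreover have "computable2 (dom i') (dom i') (\<lambda>x y. if i' x = i' y then 1 else 0)"
    proof -
      define r s where "r x y = (if j x = j y then 1 else 0 :: nat)"
        and "s x y = (if i x = i y then 1 else 0 :: nat)" for x y
      have r: "computable2 (dom j) (dom j) r" and s: "computable2 (dom i) (dom i) s"
        using j i(1) by (simp_all add: field_indexing_def indexing_iff r_def s_def del: listset.simps)
      \<comment> \<open>For tests with values 0 and 1, the truncated \<open>r + s - 1\<close> is
        their conjunction.\<close>
      have "computable2 (dom i') (dom i') (\<lambda>x y. r (l x) (l y) + s (m x) (m y) - 1)"
        by (intro computable_on_diff computable_on_add computable_on_const
            computable_on_comp2[OF r] computable_on_comp2[OF s] clm nth;
            unfold listset2, elim bexE, simp add: dom_i')
      then show ?thesis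
      proof (rule computable_on_cong)
        fix xs assume "xs \<in> listset [dom i', dom i']"
        then obtain x y where xs: "xs = [x, y]" "x \<in> dom i'" "y \<in> dom i'"
          unfolding listset2 by blast
        then obtain u v u' v' where x: "j (l x) = Some u" "i (m x) = Some v"
          and y: "j (l y) = Some u'" "i (m y) = Some v'" unfolding dom_i' by blast
        then have v: "v \<in> span S" "v' \<in> span S" using ran_i ranI by metis+
        \<comment> \<open>The decomposition is unique: if the coefficients differed, dividing by
          their difference would put \<open>b\<close> into \<open>span S\<close>.\<close>
        have "u = u' \<and> v = v'" if eq: "scale u b + v = scale u' b + v'"
        proof -
          have "scale (u - u') b = v' - v" using eq by (simp add: scale_left_diff_distrib algebra_simps)
          then have "scale (u - u') b \<in> span S" using v by (simp add: span_diff)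
          then have "scale (inverse (u - u')) (scale (u - u') b) \<in> span S" by (rule span_scale)
          with b have "u = u'" by (cases "u = u'") auto
          with eq show ?thesis by simp
        qed
        moreover have "i' x = Some (scale u b + v)" "i' y = Some (scale u' b + v')"
          using x y by (simp_all add: i'_def)
        ultimately show "r (l (xs ! 0)) (l (xs ! 1)) + s (m (xs ! 0)) (m (xs ! 1)) - 1 =
            (if i' (xs ! 0) = i' (xs ! 1) then 1 else 0)"
          using x y xs(1) by (auto simp: r_def s_def)
      qed
    qed
    ultimately have "indexing (span (insert b S)) i'" by (simp add: indexing_iff del: listset.simps)
    moreover have "computable_op i' i' i' (+)"
    proof -
      obtain r where r: "computable2 (dom j) (dom j) r"
        "\<And>x u y v. j x = Some u \<Longrightarrow> j y = Some v \<Longrightarrow> j (r x y) = Some (u + v)"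
        by (rule computable_op_fun[OF j_add]) blast
      obtain s where s: "computable2 (dom i) (dom i) s"
        "\<And>x u y v. i x = Some u \<Longrightarrow> i y = Some v \<Longrightarrow> i (s x y) = Some (u + v)"
        by (rule computable_op_fun[OF i(2)]) blast
      define f where "f x y = prod_encode (r (l x) (l y), s (m x) (m y))" for x y
      have "computable2 (dom i') (dom i') f"
        unfolding f_def
        by (intro computable_on_prod_encode
            computable_on_comp2[OF r(1)] computable_on_comp2[OF s(1)] clm nth;
            unfold listset2, elim bexE, simp add: dom_i')
      moreover have "i' (f x y) = Some (w + w')" if "i' x = Some w" "i' y = Some w'" for x y w w'
      proof -
        from that obtain u v u' v' where x: "j (l x) = Some u" "i (m x) = Some v" "w = scale u b + v"
          and y: "j (l y) = Some u'" "i (m y) = Some v'" "w' = scale u' b + v'"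
          unfolding i'_Some by blast
        then show ?thesis
          using r(2)[OF x(1) y(1)] s(2)[OF x(2) y(2)]
          by (simp add: i'_def f_def lm scale_left_distrib algebra_simps)
      qed
      ultimately show ?thesis unfolding computable_op_def by blast
    qed
    moreover have "computable_op j i' i' scale"
    proof -
      obtain r where r: "computable2 (dom j) (dom j) r"
        "\<And>x u y v. j x = Some u \<Longrightarrow> j y = Some v \<Longrightarrow> j (r x y) = Some (u * v)"
        by (rule computable_op_fun[OF j_mult]) blast
      obtain s where s: "computable2 (dom j) (dom i) s"
        "\<And>x u y v. j x = Some u \<Longrightarrow> i y = Some v \<Longrightarrow> i (s x y) = Some (scale u v)"
        by (rule computable_op_fun[OF i(3)]) blast
      \<comment> \<open>A scalar acts on both parts: on the coefficient of \<open>b\<close> by the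
        field multiplication, on the rest by the scaling already available on
        \<open>span S\<close>.\<close>
      define f where "f x y = prod_encode (r x (l y), s x (m y))" for x y
      have "computable2 (dom j) (dom i') f"
        unfolding f_def
        by (intro computable_on_prod_encode
            computable_on_comp2[OF r(1)] computable_on_comp2[OF s(1)] clm nth;
            unfold listset2, elim bexE, simp add: dom_i')
      moreover have "i' (f x y) = Some (scale a w)" if a: "j x = Some a" and "i' y = Some w" for x y a w
      proof -
        from that(2) obtain u v where y: "j (l y) = Some u" "i (m y) = Some v" "w = scale u b + v"
          unfolding i'_Some by blast
        then show ?thesis
          using r(2)[OF a y(1)] s(2)[OF a y(2)] by (simp add: i'_def f_def lm scale_right_distrib)
      qed
      ultimately show ?thesis unfolding computable_op_def by blast
    qed
    ultimately show ?case by blast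
  qed
qed

lemma ex_vector_indexing:
  assumes "finite_dimensional_vector_space scale B" and "field_indexing j"
  shows "\<exists>i. vector_indexing scale j i"
proof -
  interpret finite_dimensional_vector_space scale B by fact
  show ?thesis
    using ex_span_indexing[OF vector_space_axioms assms(2) finite_Basis independent_Basis]
    by (simp add: vector_indexing_def span_Basis)
qed

section \<open>Infinite-dimensional spaces\<close>

instance recf :: countable
  by countable_datatype

text \<open>Followed by the numbering of programs, such an injection would have an inverse mapping
  the numbers onto their power set, against Cantor's theorem.\<close>

lemma no_inj_nat_set_recf:
  fixes p :: "nat set \<Rightarrow> recf"
  shows "\<not> inj p"
proof
  assume "inj p"
  then have "inj (\<lambda>A. to_nat (p A))" by (simp add: inj_def)
  then have "surj (inv (\<lambda>A. to_nat (p A)))" by (rule inj_imp_surj_inv)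
  then show False using Cantors_theorem[of "UNIV :: nat set"] by auto
qed

text \<open>The programs for the operations on codes remain correct, because \<open>\<phi>\<close>
  commutes with addition and scaling.\<close>

lemma vector_indexing_automorphism:
  assumes "Vector_Spaces.linear scale scale \<phi>" and "bij \<phi>" and "vector_indexing scale j i"
  shows "vector_indexing scale j (map_option \<phi> \<circ> i)"
proof -
  interpret Vector_Spaces.linear scale scale \<phi> by fact
  have "inj \<phi>" and "surj \<phi>" using assms(2) by (auto simp: bij_def)
  then show ?thesis
    using assms(3) indexing_map_option[of \<phi> UNIV i]
      computable_op_map_option[where f = \<phi> and g = \<phi> and h = \<phi> and F = "(+)" and G = "(+)"
        and ?i1.0 = i and ?i2.0 = i and ?i3.0 = i]
      \<comment> \<open>The scalars keep their codes, hence \<open>id\<close> in the first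
        argument.\<close>
      computable_op_map_option[where f = id and g = \<phi> and h = \<phi> and F = scale and G = scale
        and ?i1.0 = j and ?i2.0 = i and ?i3.0 = i]
    by (simp add: vector_indexing_def add scale option.map_id0)
qed

text \<open>Infinitely many basis vectors are grouped into pairs, and the pairs with number in
  \<open>A\<close> are swapped. The last conjunct allows \<open>A\<close> to be read off from
  \<open>\<phi>\<close>, so distinct sets give distinct automorphisms.\<close>

lemma ex_swap_automorphism:
  fixes scale :: "'k::field \<Rightarrow> 'e::ab_group_add \<Rightarrow> 'e"
  assumes "vector_space scale" and indep: "\<not> module.dependent scale B"
    and span: "module.span scale B = UNIV" and f: "inj f" "range f \<subseteq> B"
  shows "\<exists>\<phi>. Vector_Spaces.linear scale scale \<phi> \<and> bij \<phi> \<and> (\<forall>n::nat. \<phi> (f (2 * n)) = f (2 * n + 1) \<longleftrightarrow> n \<in> A)"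
proof -
  interpret vector_space scale by fact
  interpret P: vector_space_pair scale scale ..
  \<comment> \<open>The indices \<open>2 * n\<close> and \<open>2 * n + 1\<close> form the pair with
    number \<open>n\<close>, so \<open>m div 2\<close> is the pair number of
    \<open>m\<close>.\<close>
  define \<pi> where "\<pi> m = (if m div 2 \<in> A then if even m then m + 1 else m - 1 else m)" for m
  have \<pi>: "\<pi> (\<pi> m) = m" for m
    by (cases "even m") (auto simp: \<pi>_def elim!: evenE oddE)
  \<comment> \<open>The permutation of indices is carried along \<open>f\<close> to the basis;
    vectors outside \<open>range f\<close> stay fixed.\<close>
  define \<sigma> where "\<sigma> b = (if b \<in> range f then f (\<pi> (inv f b)) else b)" for b
  have \<sigma>f: "\<sigma> (f n) = f (\<pi> n)" for n
    using f(1) by (simp add: \<sigma>_def)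
  have \<sigma>: "\<sigma> (\<sigma> b) = b" for b
    by (cases "b \<in> range f") (auto simp: \<sigma>f \<pi>, simp add: \<sigma>_def)
  have \<sigma>B: "\<sigma> b \<in> B" if "b \<in> B" for b
    using that f(2) by (auto simp: \<sigma>_def)
  define \<phi> where "\<phi> = P.construct B \<sigma>"
  have lin: "Vector_Spaces.linear scale scale \<phi>"
    unfolding \<phi>_def by (rule P.linear_construct[OF indep])
  have \<phi>B: "\<phi> b = \<sigma> b" if "b \<in> B" for b
    unfolding \<phi>_def by (rule P.construct_basis[OF indep that])
  \<comment> \<open>Being an involution on the basis, \<open>\<phi>\<close> is its own inverse
    everywhere, which yields bijectivity.\<close>
  have "\<phi> (\<phi> v) = v" for v
  proof -
    have "(\<phi> \<circ> \<phi>) v = id v"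
    proof (rule P.linear_eq_on[of "\<phi> \<circ> \<phi>" id])
      show "Vector_Spaces.linear scale scale (\<phi> \<circ> \<phi>)" by (rule Vector_Spaces.linear_compose[OF lin lin])
      show "Vector_Spaces.linear scale scale id" by (rule linear_id)
      show "v \<in> span B" by (simp add: span)
      show "(\<phi> \<circ> \<phi>) b = id b" if "b \<in> B" for b
        using that by (simp add: \<phi>B \<sigma>B \<sigma>)
    qed
    then show ?thesis by simp
  qed
  then have "bij \<phi>" by (intro o_bij[of \<phi> \<phi>]) auto
  moreover have "\<phi> (f (2 * n)) = f (2 * n + 1) \<longleftrightarrow> n \<in> A" for n
  proof -
    have "f (2 * n) \<in> B" using f(2) by blast
    then have "\<phi> (f (2 * n)) = f (\<pi> (2 * n))" by (simp add: \<phi>B \<sigma>f)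
    \<comment> \<open>For \<open>n\<close> outside \<open>A\<close> the vector
      \<open>f (2 * n)\<close> is fixed, and injectivity of \<open>f\<close> separates it from
      \<open>f (2 * n + 1)\<close>.\<close>
    then show ?thesis using inj_eq[OF f(1)] by (simp add: \<pi>_def)
  qed
  ultimately show ?thesis using lin by blast
qed

text \<open>A program translating \<open>\<phi> \<circ> i\<close> to \<open>i\<close> determines the automorphism \<open>\<phi>\<close>.\<close>

lemma finite_dimensional_if_translatable:
  fixes scale :: "'k::field \<Rightarrow> 'e::ab_group_add \<Rightarrow> 'e"
  assumes "vector_space scale" and i: "vector_indexing scale j i"
    and tr: "\<And>i'. vector_indexing scale j i' \<Longrightarrow> translatable i' i"
  shows "\<exists>B. finite_dimensional_vector_space scale B"
proof -
  interpret vector_space scale by fact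
  obtain B where B: "independent B" "span B = UNIV"
    by (metis maximal_independent_subset top.extremum_uniqueI)
  have "finite B"
  proof (rule ccontr)
    assume "infinite B"
    then obtain f :: "nat \<Rightarrow> 'e" where f: "inj f" "range f \<subseteq> B"
      using infinite_countable_subset by blast
    have "\<exists>\<phi>. \<forall>A. Vector_Spaces.linear scale scale (\<phi> A) \<and> bij (\<phi> A) \<and>
        (\<forall>n. \<phi> A (f (2 * n)) = f (2 * n + 1) \<longleftrightarrow> n \<in> A)"
      using ex_swap_automorphism[OF vector_space_axioms B f] by (intro choice) blast
    then obtain \<phi> where \<phi>: "\<And>A. Vector_Spaces.linear scale scale (\<phi> A)" "\<And>A. bij (\<phi> A)"
      "\<And>A n. \<phi> A (f (2 * n)) = f (2 * n + 1) \<longleftrightarrow> n \<in> A" by blast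
    have "\<exists>p. \<forall>x\<in>dom i. map_option (\<phi> A) (i x) = i (the (reval p [x]))" for A
    proof -
      have "translatable (map_option (\<phi> A) \<circ> i) i"
        by (intro tr vector_indexing_automorphism \<phi> i)
      then obtain h where h: "computable1 (dom i) h" "\<forall>x\<in>dom i. map_option (\<phi> A) (i x) = i (h x)"
        unfolding translatable_def by auto
      then obtain p where p: "\<forall>xs\<in>listset [dom i]. reval p xs = Some (h (xs ! 0))"
        unfolding computable_on_def by blast
      have "reval p [x] = Some (h x)" if "x \<in> dom i" for x
        using bspec[OF p, of "[x]"] that by (simp add: set_Cons_def)
      with h(2) show ?thesis by (intro exI[of _ p]) simp
    qed
    \<comment> \<open>One translating program is chosen for each set of numbers. The
      \<open>the\<close> is harmless, since the chosen program was seen to halt on the codes in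
      \<open>dom i\<close>.\<close>
    then obtain p where p: "\<And>A x. x \<in> dom i \<Longrightarrow> map_option (\<phi> A) (i x) = i (the (reval (p A) [x]))"
      by metis
    have "inj p"
    proof (rule injI)
      fix A C assume eq: "p A = p C"
      \<comment> \<open>Every vector has a code in \<open>i\<close>, so what the common program does
        on codes fixes the value of the automorphism at every vector.\<close>
      have "\<phi> A v = \<phi> C v" for v
      proof -
        obtain x where x: "i x = Some v"
          using i indexing_code unfolding vector_indexing_def by (metis UNIV_I)
        then have "x \<in> dom i" by blast
        from p[OF this, of A] p[OF this, of C] eq
        have "map_option (\<phi> A) (i x) = map_option (\<phi> C) (i x)" by simp
        with x show ?thesis by simp
      qed
      then have "n \<in> A \<longleftrightarrow> n \<in> C" for n
        using \<phi>(3)[of A n] \<phi>(3)[of C n] by simp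
      then show "A = C" by blast
    qed
    then show False using no_inj_nat_set_recf by blast
  qed
  then have "finite_dimensional_vector_space scale B" using B by unfold_locales
  then show ?thesis ..
qed

theorem proposition9:
  fixes scale :: "'k::field \<Rightarrow> 'e::ab_group_add \<Rightarrow> 'e"
  assumes "vector_space scale"
  shows "stable_computability (vector_space_structure scale) \<longleftrightarrow>
         stable_computability (field_structure :: 'k many_sorted) \<and>
         (\<exists>B. finite_dimensional_vector_space scale B)"
proof
  assume "stable_computability (vector_space_structure scale)"
  then obtain j i where ji: "field_indexing j" "vector_indexing scale j i"
    and tr: "\<And>j i j' i'. field_indexing j \<Longrightarrow> vector_indexing scale j i \<Longrightarrow>
      field_indexing j' \<Longrightarrow> vector_indexing scale j' i' \<Longrightarrow> translatable j' j \<and> translatable i' i"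
    unfolding stable_vector_iff by blast
  \<comment> \<open>Stability is applied with the same \<open>j\<close> on both sides, so that only
    the indexing of the vectors varies.\<close>
  obtain B where B: "finite_dimensional_vector_space scale B"
    using finite_dimensional_if_translatable[OF assms ji(2)] tr ji by blast
  \<comment> \<open>Two indexings of the field each extend to the space, and the scalar part of the
    resulting translations is the one sought.\<close>
  have "stable_computability (field_structure :: 'k many_sorted)"
    unfolding stable_field_iff using ji(1) tr ex_vector_indexing[OF B] by blast
  with B show "stable_computability (field_structure :: 'k many_sorted) \<and>
      (\<exists>B. finite_dimensional_vector_space scale B)" by blast
next
  assume "stable_computability (field_structure :: 'k many_sorted) \<and>
      (\<exists>B. finite_dimensional_vector_space scale B)"
  then obtain j :: "nat \<rightharpoonup> 'k" and B where j: "field_indexing j"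
    and tr: "\<And>j j' :: nat \<rightharpoonup> 'k. field_indexing j \<Longrightarrow> field_indexing j' \<Longrightarrow> translatable j' j"
    and B: "finite_dimensional_vector_space scale B"
    unfolding stable_field_iff by blast
  have "translatable i' i"
    if "field_indexing j" "vector_indexing scale j i" "field_indexing j'" "vector_indexing scale j' i'"
    for j i j' i'
    using vector_translatable[OF B _ tr] that by (auto simp: field_indexing_def)
  then show "stable_computability (vector_space_structure scale)"
    unfolding stable_vector_iff using j tr ex_vector_indexing[OF B j] by blast
qed

end
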